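(* Let $m,n\ge1$, $d=m+n$, and let $\Lambda\subset\mathbb{R}^d\setminus\{0\}$ be discrete and without vertical vectors, with $\mathrm{Exp}(\Lambda)$ non-empty. Let $\beta=\beta(\Lambda)$ and $\gamma=\gamma(\Lambda)$. 1. For all $\nu\in\mathrm{Exp}(\Lambda)$, $\beta\ge1-\frac1\nu$. 2. Suppose $\beta>0$. Then $\left(1,\frac{1}{1-\beta}\right)\subset\mathrm{Exp}(\Lambda)$. 3. For all $\nu\in\mathrm{Exp}(\Lambda)$, $\gamma\ge\frac md-\frac1\nu$. 4. Suppose $\gamma\ge0$. Then $\left(0,\frac{1}{\frac md-\gamma}\right)\subset\mathrm{Exp}(\Lambda)$.
   Context: Write $\mathbb{R}^d=\mathbb{R}^m\times\mathbb{R}^n$ with projections $p_1,p_2$. A vector $\mathbf{v}$ is vertical if $p_1(\mathbf{v})=0$. A subset of $\mathbb{R}^d$ is discrete if it has only finitely many points in each bounded set. Let $\|\mathbf{v}\|=\max(\|p_1(\mathbf{v})\|_2,\|p_2(\mathbf{v})\|_2)$, where $\|\cdot\|_2$ is the Euclidean norm (also used for matrices), and $\alpha_1(\Lambda)=\sup_{\mathbf{v}\in\Lambda}1/\|\mathbf{v}\|$. Let $$g_t=\begin{pmatrix}e^{nt/d}I_m&0\\0&e^{-mt/d}I_n\end{pmatrix},\qquad h_B=\begin{pmatrix}I_m&0\\ B&I_n\end{pmatrix}\ (B\in M_{n\times m}(\mathbb{R})),\qquad \mathcal{B}_s=\{h_B:\|B\|_2\le s\},$$ $$\beta(\Lambda)=\limsup_{s\to\infty}\frac{\sup_{h\in\mathcal{B}_s}\log\alpha_1(h\Lambda)}{\log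 s},\qquad \gamma(\Lambda)=\limsup_{t\to\infty}\frac{\log\alpha_1(g_t\Lambda)}{t}.$$ $\mathrm{Exp}(\Lambda)$ is the set of all $\nu>0$ for which there are $C>0$ and a sequence $\mathbf{v}_k\in\Lambda$ with $\|p_2(\mathbf{v}_k)\|_2\to\infty$ and $\|p_1(\mathbf{v}_k)\|_2<C\|p_2(\mathbf{v}_k)\|_2^{-(\nu-1)}$. The convention $1/0=+\infty$ is used for the interval endpoints. *)

theory Defs
  imports "HOL-Analysis.Analysis"
begin

text \<open>
  The space \<open>\<real>\<^sup>d = \<real>\<^sup>m \<times> \<real>\<^sup>n\<close> is the product type \<open>(real ^ 'm) \<times> (real ^ 'n)\<close>, with
  \<open>m = CARD('m)\<close>, \<open>n = CARD('n)\<close> and projections \<^const>\<open>fst\<close> and \<^const>\<open>snd\<close>. The library norm on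
  this type is the Euclidean one, hence the separate maximum norm.
\<close>

type_synonym ('m, 'n) space = "(real ^ 'm) \<times> (real ^ 'n)"

definition max_norm :: "('m::finite, 'n::finite) space \<Rightarrow> real" where
  "max_norm v = max (norm (fst v)) (norm (snd v))"

definition vertical :: "('m::finite, 'n::finite) space \<Rightarrow> bool" where
  "vertical v \<longleftrightarrow> fst v = 0"

text \<open>Stronger than the topological notion: accumulation points outside the set are excluded too.\<close>

definition locally_finite_set :: "'a::metric_space set \<Rightarrow> bool" where
  "locally_finite_set A \<longleftrightarrow> (\<forall>S. bounded S \<longrightarrow> finite (A \<inter> S))"

text \<open>
  A real supremum. It is a genuine one for every non-empty \<open>\<Lambda>\<close> with finitely many points in each
  bounded set and \<open>0 \<notin> \<Lambda>\<close>, and these properties are preserved by linear bijections.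
\<close>

definition alpha1 :: "('m::finite, 'n::finite) space set \<Rightarrow> real" where
  "alpha1 \<Lambda> = (SUP v\<in>\<Lambda>. 1 / max_norm v)"

text \<open>The block matrices \<open>g\<^sub>t\<close> and \<open>h\<^sub>B\<close>, as the linear maps they induce on column vectors \<open>(x, y)\<close>.\<close>

definition diag_flow :: "real \<Rightarrow> ('m::finite, 'n::finite) space \<Rightarrow> ('m, 'n) space" where
  "diag_flow t = (\<lambda>(x, y).
     (exp (real CARD('n) * t / real (CARD('m) + CARD('n))) *\<^sub>R x,
      exp (- (real CARD('m) * t / real (CARD('m) + CARD('n)))) *\<^sub>R y))"

definition shear :: "real ^ 'm ^ 'n \<Rightarrow> ('m::finite, 'n::finite) space \<Rightarrow> ('m, 'n) space" where
  "shear B = (\<lambda>(x, y). (x, B *v x + y))"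

text \<open>The library norm of a matrix is the Euclidean norm of its entries.\<close>

definition shears :: "real \<Rightarrow> (('m::finite, 'n::finite) space \<Rightarrow> ('m, 'n) space) set" where
  "shears s = {shear B | B. norm B \<le> s}"

definition beta_exp :: "('m::finite, 'n::finite) space set \<Rightarrow> ereal" where
  "beta_exp \<Lambda> =
     Limsup at_top (\<lambda>s::real. (SUP h\<in>shears s. ereal (ln (alpha1 (h ` \<Lambda>)))) / ereal (ln s))"

definition gamma_exp :: "('m::finite, 'n::finite) space set \<Rightarrow> ereal" where
  "gamma_exp \<Lambda> = Limsup at_top (\<lambda>t::real. ereal (ln (alpha1 (diag_flow t ` \<Lambda>)) / t))"

text \<open>
  Since \<open>norm (snd (v k))\<close> tends to infinity, the value of \<^const>\<open>powr\<close> at base \<open>0\<close> matters for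
  at most finitely many \<open>k\<close>, which can be dropped from the sequence.
\<close>

definition Exp_set :: "('m::finite, 'n::finite) space set \<Rightarrow> real set" where
  "Exp_set \<Lambda> = {\<nu>. \<nu> > 0 \<and> (\<exists>C>0. \<exists>v :: nat \<Rightarrow> ('m, 'n) space.
     (\<forall>k. v k \<in> \<Lambda>) \<and>
     filterlim (\<lambda>k. norm (snd (v k))) at_top sequentially \<and>
     (\<forall>k. norm (fst (v k)) < C * norm (snd (v k)) powr (- (\<nu> - 1))))}"

end

theory Submission
  imports Defs
begin

text \<open>
  Call the elements of \<open>Exp_set \<Lambda>\<close> the exponents of \<open>\<Lambda>\<close>.
  For \<open>v = (x, y)\<close> in \<open>\<Lambda>\<close> with \<open>x, y \<noteq> 0\<close> put \<open>T = ln \<bar>y\<bar> - ln \<bar>x\<bar>\<close>. Both flows are governed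
  by this one parameter: the smallest shear that kills the second component of \<open>v\<close> is the rank-one
  matrix \<open>B = - y x\<^sup>T / \<bar>x\<bar>\<^sup>2\<close> of norm \<open>exp T\<close>, and \<open>T\<close> is also the time at which the two components
  of \<open>g\<^sub>t v\<close> have equal length. At that moment the logarithm of \<open>\<alpha>\<^sub>1\<close> is at least \<open>T - ln \<bar>y\<bar>\<close>,
  respectively \<open>(m/d) T - ln \<bar>y\<bar>\<close>. If \<open>\<nu>\<close> is an exponent of \<open>\<Lambda>\<close>, then \<open>ln \<bar>y\<bar> \<le> c T\<close> for
  every \<open>c > 1/\<nu>\<close> at arbitrarily large \<open>T\<close> (\<open>Exp_set_frequently\<close>), which gives the two lower bounds.

  Conversely, let \<open>\<nu> > 1\<close>. Largeness of \<open>\<alpha>\<^sub>1\<close> after a shear of norm at most \<open>exp T\<close>, or at time \<open>T\<close>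
  of the diagonal flow, yields vectors of \<open>\<Lambda>\<close> with \<open>\<bar>x\<bar> < exp (- (1 - 1/\<nu>) T)\<close> and
  \<open>\<bar>y\<bar> \<le> 2 exp (T/\<nu>)\<close>. Here \<open>\<bar>x\<bar>\<close> tends to \<open>0\<close> without vanishing, so discreteness forces
  \<open>\<bar>y\<bar>\<close> to infinity, and eliminating \<open>T\<close> shows that \<open>\<nu>\<close> is an exponent (\<open>Exp_setI\<close>).

  For the diagonal flow the exponents \<open>\<nu> \<le> 1\<close> follow because the set of exponents is closed
  downwards: as \<open>\<gamma> \<ge> 0\<close>, the interval in question, if non-empty, extends at least to \<open>d/m > 1\<close>.
\<close>

section \<open>The norm of vectors and of matrices\<close>

lemma norm_matrix_vector_mult_le:
  fixes B :: "real ^ 'm::finite ^ 'n::finite"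
  shows "norm (B *v x) \<le> norm B * norm x"
proof -
  have "norm (B *v x) = L2_set (\<lambda>i. \<bar>inner (B $ i) x\<bar>) UNIV"
    by (simp add: norm_vec_def matrix_vector_mul_component)
  also have "\<dots> \<le> L2_set (\<lambda>i. norm (B $ i) * norm x) UNIV"
    by (intro L2_set_mono) (auto simp: Cauchy_Schwarz_ineq2)
  also have "\<dots> = norm B * norm x"
    by (simp add: L2_set_left_distrib norm_vec_def [of B])
  finally show ?thesis .
qed

lemma exists_matrix_mapping:
  fixes x :: "real ^ 'm::finite" and y :: "real ^ 'n::finite"
  assumes "x \<noteq> 0"
  obtains B :: "real ^ 'm ^ 'n" where "B *v x = y" "norm B = norm y / norm x"
proof -
  \<comment> \<open>The rank-one matrix \<open>y x\<^sup>T / \<bar>x\<bar>\<^sup>2\<close>.\<close>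
  define B :: "real ^ 'm ^ 'n" where "B = (\<chi> i. (y $ i / (norm x)\<^sup>2) *\<^sub>R x)"
  have "B *v x = y"
    using assms
    by (simp add: vec_eq_iff matrix_vector_mul_component B_def power2_norm_eq_inner)
  moreover have "norm B = norm y / norm x"
  proof -
    have "norm B = L2_set (\<lambda>i. \<bar>y $ i\<bar> * (1 / norm x)) UNIV"
      unfolding norm_vec_def [of B] using assms by (simp add: B_def power2_eq_square)
    also have "\<dots> = norm y * (1 / norm x)"
      unfolding norm_vec_def [of y] by (subst L2_set_left_distrib) auto
    finally show ?thesis by simp
  qed
  ultimately show ?thesis using that by blast
qed

lemma max_norm_pos: "v \<noteq> 0 \<Longrightarrow> max_norm v > 0"
  by (auto simp: max_norm_def prod_eq_iff less_max_iff_disj)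

lemma max_norm_le_shear:
  "max_norm v \<le> (1 + norm B) * max_norm (shear B v)"
proof -
  obtain x y where v: "v = (x, y)" by fastforce
  let ?M = "max_norm (shear B v)"
  have x: "norm x \<le> ?M" and z: "norm (B *v x + y) \<le> ?M"
    by (auto simp: max_norm_def shear_def v)
  have "norm y \<le> norm (B *v x + y) + norm (B *v x)"
    by (metis add_diff_cancel_left' norm_triangle_ineq4)
  also have "\<dots> \<le> ?M + norm B * ?M"
    using z norm_matrix_vector_mult_le [of B x] mult_left_mono [OF x, of "norm B"] by simp
  finally have "norm y \<le> (1 + norm B) * ?M" by (simp add: algebra_simps)
  moreover have "norm x \<le> (1 + norm B) * ?M"
    using x order_trans [OF norm_ge_zero x] by (simp add: algebra_simps add_increasing2)
  ultimately show ?thesis by (simp add: v max_norm_def [of "(x, y)"])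
qed

lemma max_norm_diag_flow:
  fixes v :: "('m::finite, 'n::finite) space"
  shows "max_norm (diag_flow t v) =
    max (exp (real CARD('n) * t / real (CARD('m) + CARD('n))) * norm (fst v))
        (exp (- (real CARD('m) * t / real (CARD('m) + CARD('n)))) * norm (snd v))"
  by (simp add: max_norm_def diag_flow_def case_prod_beta)

lemma max_norm_le_diag_flow:
  "\<exists>K>0. \<forall>v :: ('m::finite, 'n::finite) space. max_norm v \<le> K * max_norm (diag_flow t v)"
proof -
  define a where "a = real CARD('n) * t / real (CARD('m) + CARD('n))"
  define b where "b = - (real CARD('m) * t / real (CARD('m) + CARD('n)))"
  have "max_norm v \<le> (exp (- a) + exp (- b)) * max_norm (diag_flow t v)" for v :: "('m, 'n) space"
  proof -
    let ?M = "max_norm (diag_flow t v)"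
    have M: "exp a * norm (fst v) \<le> ?M" "exp b * norm (snd v) \<le> ?M"
      by (auto simp: max_norm_diag_flow a_def b_def)
    then have "?M \<ge> 0" by (meson exp_ge_zero mult_nonneg_nonneg norm_ge_zero order_trans)
    have "norm (fst v) \<le> exp (- a) * ?M" "norm (snd v) \<le> exp (- b) * ?M"
      using M by (simp_all add: exp_minus field_simps)
    then show ?thesis
      using \<open>?M \<ge> 0\<close> by (auto simp: max_norm_def [of v] algebra_simps add_increasing add_increasing2)
  qed
  then show ?thesis by (intro exI [of _ "exp (- a) + exp (- b)"]) (auto intro: add_pos_pos)
qed

section \<open>The reciprocal of the shortest length\<close>

lemma locally_finite_norm_bounded_below:
  fixes f :: "'a::metric_space \<Rightarrow> real"
  assumes "locally_finite_set A" and "bounded {v \<in> A. f v \<le> R}" and "\<And>v. v \<in> A \<Longrightarrow> f v > 0"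
    and "R > 0"
  obtains \<delta> where "\<delta> > 0" "\<And>v. v \<in> A \<Longrightarrow> \<delta> \<le> f v"
proof -
  let ?S = "{v \<in> A. f v \<le> R}"
  have "finite (A \<inter> ?S)"
    using assms by (auto simp: locally_finite_set_def)
  then have fin: "finite (insert R (f ` ?S))"
    by (simp add: Int_absorb1)
  define \<delta> where "\<delta> = Min (insert R (f ` ?S))"
  have "\<delta> > 0"
    using fin assms by (auto simp: \<delta>_def Min_gr_iff)
  moreover have "\<delta> \<le> f v" if "v \<in> A" for v
  proof (cases "f v \<le> R")
    case True
    then show ?thesis using fin that by (auto simp: \<delta>_def intro!: Min_le)
  next
    case False
    moreover have "\<delta> \<le> R" using fin by (auto simp: \<delta>_def intro!: Min_le)
    ultimately show ?thesis by simp
  qed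
  ultimately show ?thesis using that by blast
qed

lemma bounded_max_norm_le: "bounded {v :: ('m::finite, 'n::finite) space. max_norm v \<le> R}"
proof -
  have "{v :: ('m, 'n) space. max_norm v \<le> R} \<subseteq> cball 0 R \<times> cball 0 R"
    by (auto simp: max_norm_def)
  then show ?thesis by (rule bounded_subset [OF bounded_Times [OF bounded_cball bounded_cball]])
qed

text \<open>
  Both flows consist of maps \<open>f\<close> that contract \<^const>\<open>max_norm\<close> at most by a constant factor \<open>K\<close>,
  so the images of \<open>\<Lambda>\<close> stay away from \<open>0\<close>.
\<close>

context
  fixes \<Lambda> :: "('m::finite, 'n::finite) space set"
    and f :: "('m, 'n) space \<Rightarrow> ('m, 'n) space" and K :: real
  assumes \<Lambda>: "locally_finite_set \<Lambda>" "0 \<notin> \<Lambda>"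
    and f: "\<And>v. max_norm v \<le> K * max_norm (f v)" and K: "K > 0"
begin

lemma max_norm_image_pos: "v \<in> \<Lambda> \<Longrightarrow> max_norm (f v) > 0"
proof -
  assume "v \<in> \<Lambda>"
  then have "0 < max_norm v" using \<Lambda>(2) by (intro max_norm_pos) auto
  then have "0 < K * max_norm (f v)" using f by (rule less_le_trans)
  then show ?thesis using K by (simp add: zero_less_mult_iff)
qed

text \<open>The real-valued supremum in \<^const>\<open>alpha1\<close> is taken over a bounded set.\<close>

lemma bdd_above_alpha1: "bdd_above ((\<lambda>v. 1 / max_norm v) ` f ` \<Lambda>)"
proof -
  have "bounded {v \<in> \<Lambda>. max_norm v \<le> 1}"
    by (rule bounded_subset [OF bounded_max_norm_le [of 1]]) auto
  then obtain \<delta> where \<delta>: "\<delta> > 0" "\<And>v. v \<in> \<Lambda> \<Longrightarrow> \<delta> \<le> max_norm v"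
    using locally_finite_norm_bounded_below [OF \<Lambda>(1), of max_norm 1] \<Lambda>(2) max_norm_pos
    by (metis zero_less_one)
  have "1 / max_norm (f v) \<le> K / \<delta>" if "v \<in> \<Lambda>" for v
    using order_trans [OF \<delta>(2) f, OF that] max_norm_image_pos [OF that] \<delta>(1) K
    by (simp add: field_simps)
  then show ?thesis by (auto intro!: bdd_aboveI)
qed

lemma alpha1_ge:
  assumes "v \<in> \<Lambda>"
  shows "1 / max_norm (f v) \<le> alpha1 (f ` \<Lambda>)"
  unfolding alpha1_def using assms bdd_above_alpha1 by (intro cSUP_upper) auto

lemma ln_alpha1_ge:
  assumes "v \<in> \<Lambda>"
  shows "- ln (max_norm (f v)) \<le> ln (alpha1 (f ` \<Lambda>))"
proof -
  have "- ln (max_norm (f v)) = ln (1 / max_norm (f v))"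
    using max_norm_image_pos [OF assms] by (simp add: ln_div)
  also have "\<dots> \<le> ln (alpha1 (f ` \<Lambda>))"
    using alpha1_ge [OF assms] max_norm_image_pos [OF assms]
    by (smt (verit) divide_pos_pos ln_le_cancel_iff)
  finally show ?thesis .
qed

lemma ln_alpha1_gtD:
  assumes "a < ln (alpha1 (f ` \<Lambda>))" and "\<Lambda> \<noteq> {}"
  obtains v where "v \<in> \<Lambda>" "max_norm (f v) < exp (- a)"
proof -
  obtain w where w: "w \<in> \<Lambda>" using assms by blast
  then have "alpha1 (f ` \<Lambda>) > 0"
    using alpha1_ge max_norm_image_pos by (meson divide_pos_pos less_le_trans zero_less_one)
  then have "exp a < alpha1 (f ` \<Lambda>)"
    using assms(1) by (metis exp_less_cancel_iff exp_ln)
  then obtain v where v: "v \<in> \<Lambda>" "exp a < 1 / max_norm (f v)"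
    using less_cSUP_iff [OF _ bdd_above_alpha1] assms(2) unfolding alpha1_def by auto
  then have "max_norm (f v) < exp (- a)"
    using max_norm_image_pos [OF v(1)] by (simp add: exp_minus field_simps)
  with v(1) show ?thesis using that by blast
qed

end

section \<open>Exponents and the logarithmic ratio of the components\<close>

lemma frequently_at_top_iff:
  "(\<exists>\<^sub>F x in at_top. P x) \<longleftrightarrow> (\<forall>a. \<exists>x\<ge>a. P x)" for P :: "real \<Rightarrow> bool"
  by (auto simp: frequently_def eventually_at_top_linorder)

lemma Exp_set_frequently:
  fixes \<Lambda> :: "('m::finite, 'n::finite) space set"
  assumes nv: "\<forall>v\<in>\<Lambda>. \<not> vertical v" and \<nu>: "\<nu> \<in> Exp_set \<Lambda>" and c: "c > 1 / \<nu>"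
  shows "\<exists>\<^sub>F T in at_top. \<exists>v\<in>\<Lambda>. snd v \<noteq> 0 \<and> T = ln (norm (snd v)) - ln (norm (fst v)) \<and>
           ln (norm (snd v)) \<le> c * T"
  unfolding frequently_at_top_iff
proof
  fix T0 :: real
  obtain C v where "\<nu> > 0" and C: "C > 0" and v: "\<And>k. v k \<in> \<Lambda>"
    and lim: "filterlim (\<lambda>k. norm (snd (v k))) at_top sequentially"
    and le: "\<And>k::nat. norm (fst (v k)) < C * norm (snd (v k)) powr (- (\<nu> - 1))"
    using \<nu> by (auto simp: Exp_set_def)
  \<comment> \<open>Once \<open>\<nu> Y > R\<close>, the bound \<open>\<nu> Y < T + ln C\<close> below gives both \<open>T > T0\<close> and \<open>Y \<le> c T\<close>.\<close>
  define R where "R = max (T0 + ln C + 1) (ln C + ln C / \<nu> / (c - 1 / \<nu>))"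
  have "\<forall>\<^sub>F k in sequentially. norm (snd (v k)) > exp (R / \<nu>)"
    using lim by (simp add: filterlim_at_top_dense)
  then obtain k where k: "norm (snd (v k)) > exp (R / \<nu>)"
    by (auto simp: eventually_sequentially)
  define X Y T where "X = ln (norm (fst (v k)))" and "Y = ln (norm (snd (v k)))" and "T = Y - X"
  have y: "norm (snd (v k)) > 0" using k by (smt (verit) exp_gt_zero)
  have x: "norm (fst (v k)) > 0" using nv v [of k] by (auto simp: vertical_def)
  have "R / \<nu> < Y"
    unfolding Y_def using k y by (metis exp_less_cancel_iff exp_ln)
  then have "R < \<nu> * Y" using \<open>\<nu> > 0\<close> by (simp add: field_simps)
  have "X < ln (C * norm (snd (v k)) powr (- (\<nu> - 1)))"
    unfolding X_def using le [of k] x by (meson ln_less_cancel_iff less_trans)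
  also have "\<dots> = ln C - (\<nu> - 1) * Y"
    using C y by (simp add: ln_mult ln_powr Y_def algebra_simps)
  finally have T: "\<nu> * Y < T + ln C" by (simp add: T_def algebra_simps)
  with \<open>R < \<nu> * Y\<close> have "T > R - ln C" by simp
  then have "T > T0" and T': "T > ln C / \<nu> / (c - 1 / \<nu>)" by (auto simp: R_def)
  have "c - 1 / \<nu> > 0" using c by simp
  with T' have "ln C / \<nu> < T * (c - 1 / \<nu>)"
    using pos_divide_less_eq by blast
  moreover have "Y < T / \<nu> + ln C / \<nu>" using T \<open>\<nu> > 0\<close> by (simp add: field_simps)
  ultimately have "Y \<le> c * T" by (simp add: algebra_simps)
  then show "\<exists>T\<ge>T0. \<exists>v\<in>\<Lambda>. snd v \<noteq> 0 \<and> T = ln (norm (snd v)) - ln (norm (fst v)) \<and>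
      ln (norm (snd v)) \<le> c * T"
    using v [of k] y \<open>T > T0\<close> by (intro exI [of _ T]) (auto simp: T_def X_def Y_def)
qed

text \<open>
  In a strip \<open>\<bar>y\<bar> \<le> R\<close> only finitely many vectors of \<open>\<Lambda>\<close> have \<open>\<bar>x\<bar> \<le> 1\<close>, and none has \<open>x = 0\<close>,
  so \<open>\<bar>x\<bar>\<close> is bounded away from \<open>0\<close> there.
\<close>

lemma snd_tendsto_infinity:
  fixes v :: "nat \<Rightarrow> ('m::finite, 'n::finite) space"
  assumes lf: "locally_finite_set \<Lambda>" and nv: "\<forall>v\<in>\<Lambda>. \<not> vertical v"
    and v: "\<And>k. v k \<in> \<Lambda>" and lim: "(\<lambda>k. norm (fst (v k))) \<longlonglongrightarrow> 0"
  shows "filterlim (\<lambda>k. norm (snd (v k))) at_top sequentially"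
  unfolding filterlim_at_top_dense
proof
  fix R :: real
  define A where "A = \<Lambda> \<inter> {v. norm (snd v) \<le> R}"
  have lfA: "locally_finite_set A"
    using lf unfolding A_def locally_finite_set_def
    by (metis finite_Int inf.commute inf_left_commute)
  have "{v \<in> A. norm (fst v) \<le> 1} \<subseteq> cball 0 1 \<times> cball 0 R" by (auto simp: A_def)
  then have "bounded {v \<in> A. norm (fst v) \<le> 1}"
    by (rule bounded_subset [OF bounded_Times [OF bounded_cball bounded_cball]])
  moreover have "norm (fst v) > 0" if "v \<in> A" for v
    using nv that by (auto simp: A_def vertical_def)
  ultimately obtain \<delta> where \<delta>: "\<delta> > 0" "\<And>v. v \<in> A \<Longrightarrow> \<delta> \<le> norm (fst v)"
    using locally_finite_norm_bounded_below [OF lfA, of "\<lambda>v. norm (fst v)" 1] by auto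
  have "\<forall>\<^sub>F k in sequentially. norm (fst (v k)) < \<delta>"
    using lim \<delta>(1) by (rule order_tendstoD(2))
  then show "\<forall>\<^sub>F k in sequentially. R < norm (snd (v k))"
  proof eventually_elim
    case (elim k)
    then show ?case using \<delta>(2) [of "v k"] v [of k] by (force simp: A_def)
  qed
qed

lemma Exp_setI:
  fixes \<Lambda> :: "('m::finite, 'n::finite) space set"
  assumes lf: "locally_finite_set \<Lambda>" and nv: "\<forall>v\<in>\<Lambda>. \<not> vertical v" and \<nu>: "\<nu> > 1"
    and freq: "\<exists>\<^sub>F T in at_top. \<exists>v\<in>\<Lambda>. norm (fst v) < exp (- (1 - 1 / \<nu>) * T) \<and>
                 norm (snd v) \<le> 2 * exp (T / \<nu>)"
  shows "\<nu> \<in> Exp_set \<Lambda>"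
proof -
  have "\<exists>T v. T \<ge> real k \<and> v \<in> \<Lambda> \<and> norm (fst v) < exp (- (1 - 1 / \<nu>) * T) \<and>
          norm (snd v) \<le> 2 * exp (T / \<nu>)" for k :: nat
    using freq unfolding frequently_at_top_iff by blast
  then obtain T v where T: "\<And>k. T k \<ge> real k" and v: "\<And>k. v k \<in> \<Lambda>"
    and x: "\<And>k. norm (fst (v k)) < exp (- (1 - 1 / \<nu>) * T k)"
    and y: "\<And>k::nat. norm (snd (v k)) \<le> 2 * exp (T k / \<nu>)"
    by metis
  have "filterlim T at_top sequentially"
    by (rule filterlim_at_top_mono [OF filterlim_real_sequentially]) (simp add: T)
  then have "filterlim (\<lambda>k. - (1 - 1 / \<nu>) * T k) at_bot sequentially"
    using \<nu> by (intro filterlim_tendsto_neg_mult_at_bot [OF tendsto_const]) auto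
  then have lim0: "(\<lambda>k. exp (- (1 - 1 / \<nu>) * T k)) \<longlonglongrightarrow> 0"
    by (rule filterlim_compose [OF exp_at_bot])
  have "(\<lambda>k. norm (fst (v k))) \<longlonglongrightarrow> 0"
    by (rule tendsto_sandwich [OF _ _ tendsto_const lim0])
      (use x in \<open>auto intro!: always_eventually less_imp_le\<close>)
  then have lim: "filterlim (\<lambda>k. norm (snd (v k))) at_top sequentially"
    by (rule snd_tendsto_infinity [OF lf nv v])
  then obtain N where N: "\<And>k. k \<ge> N \<Longrightarrow> norm (snd (v k)) > 0"
    unfolding filterlim_at_top_dense eventually_sequentially by blast
  have "norm (fst (v k)) < 2 powr (\<nu> - 1) * norm (snd (v k)) powr (- (\<nu> - 1))" if "k \<ge> N" for k
  proof -
    let ?y = "norm (snd (v k))"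
    have "ln (?y / 2) \<le> ln (exp (T k / \<nu>))"
      using y [of k] N [OF that] by (intro ln_mono) auto
    then have "ln (?y / 2) \<le> T k / \<nu>" by simp
    then have "(\<nu> - 1) * ln (?y / 2) \<le> (\<nu> - 1) * (T k / \<nu>)"
      using \<nu> by (intro mult_left_mono) auto
    also have "\<dots> = (1 - 1 / \<nu>) * T k" using \<nu> by (simp add: field_simps)
    finally have "exp (- (1 - 1 / \<nu>) * T k) \<le> (?y / 2) powr (- (\<nu> - 1))"
      using N [OF that] by (simp add: powr_def algebra_simps)
    also have "\<dots> = 2 powr (\<nu> - 1) * ?y powr (- (\<nu> - 1))"
      using N [OF that] by (simp add: powr_def ln_div algebra_simps flip: exp_add)
    finally show ?thesis using x [of k] by simp
  qed
  \<comment> \<open>Finitely many terms are dropped, for which the second component might vanish.\<close>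
  then have "\<forall>k. norm (fst (v (k + N))) < 2 powr (\<nu> - 1) * norm (snd (v (k + N))) powr (- (\<nu> - 1))"
    by simp
  moreover have "filterlim (\<lambda>k. norm (snd (v (k + N)))) at_top sequentially"
    by (rule filterlim_compose [OF lim filterlim_add_const_nat_at_top])
  ultimately show ?thesis
    unfolding Exp_set_def using \<nu> v
    by (intro CollectI conjI exI [of _ "2 powr (\<nu> - 1)"] exI [of _ "\<lambda>k. v (k + N)"]) auto
qed

lemma Exp_set_downward:
  assumes \<nu>: "\<nu> \<in> Exp_set \<Lambda>" and \<mu>: "0 < \<mu>" "\<mu> \<le> \<nu>"
  shows "\<mu> \<in> Exp_set \<Lambda>"
proof -
  obtain C v where C: "C > 0" and v: "\<And>k. v k \<in> \<Lambda>"
    and lim: "filterlim (\<lambda>k. norm (snd (v k))) at_top sequentially"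
    and le: "\<And>k::nat. norm (fst (v k)) < C * norm (snd (v k)) powr (- (\<nu> - 1))"
    using \<nu> by (auto simp: Exp_set_def)
  obtain N where N: "\<And>k. k \<ge> N \<Longrightarrow> norm (snd (v k)) > 1"
    using lim unfolding filterlim_at_top_dense eventually_sequentially by blast
  have "norm (fst (v (k + N))) < C * norm (snd (v (k + N))) powr (- (\<mu> - 1))" for k
  proof -
    have "norm (snd (v (k + N))) powr (- (\<nu> - 1)) \<le> norm (snd (v (k + N))) powr (- (\<mu> - 1))"
      using N [of "k + N"] \<mu> by (intro powr_mono) auto
    then show ?thesis using le [of "k + N"] C by (smt (verit) mult_left_mono)
  qed
  moreover have "filterlim (\<lambda>k. norm (snd (v (k + N)))) at_top sequentially"
    by (rule filterlim_compose [OF lim filterlim_add_const_nat_at_top])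
  ultimately show ?thesis
    unfolding Exp_set_def using \<mu> v C
    by (intro CollectI conjI exI [of _ C] exI [of _ "\<lambda>k. v (k + N)"]) auto
qed

section \<open>The growth exponent along the shears\<close>

lemma beta_exp_ge:
  fixes \<Lambda> :: "('m::finite, 'n::finite) space set"
  assumes \<Lambda>: "locally_finite_set \<Lambda>" "0 \<notin> \<Lambda>" and nv: "\<forall>v\<in>\<Lambda>. \<not> vertical v"
    and \<nu>: "\<nu> \<in> Exp_set \<Lambda>"
  shows "ereal (1 - 1 / \<nu>) \<le> beta_exp \<Lambda>"
proof (rule ccontr)
  let ?F = "\<lambda>s. (SUP h\<in>shears s. ereal (ln (alpha1 (h ` \<Lambda>)))) / ereal (ln s)"
  assume "\<not> ?thesis"
  then obtain z where z: "beta_exp \<Lambda> < ereal z" "z < 1 - 1 / \<nu>"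
    using ereal_dense2 [of "beta_exp \<Lambda>" "ereal (1 - 1 / \<nu>)"] by (auto simp: not_le)
  have "\<forall>\<^sub>F s in at_top. ?F s < ereal z"
    using z(1) unfolding beta_exp_def by (rule Limsup_lessD)
  then have "\<forall>\<^sub>F T in at_top. ?F (exp T) < ereal z"
    by (rule eventually_compose_filterlim [OF _ exp_at_top])
  then have ev: "\<forall>\<^sub>F T in at_top. ?F (exp T) < ereal z \<and> T > 0"
    by (intro eventually_conj eventually_gt_at_top)
  have freq: "\<exists>\<^sub>F T in at_top. \<exists>v\<in>\<Lambda>. snd v \<noteq> 0 \<and> T = ln (norm (snd v)) - ln (norm (fst v)) \<and>
           ln (norm (snd v)) \<le> (1 - z) * T"
    using z(2) by (intro Exp_set_frequently [OF nv \<nu>]) auto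
  obtain T v where *: "?F (exp T) < ereal z" "T > 0" and v: "v \<in> \<Lambda>" "snd v \<noteq> 0"
    and T: "T = ln (norm (snd v)) - ln (norm (fst v))" "ln (norm (snd v)) \<le> (1 - z) * T"
    using frequently_ex [OF frequently_eventually_frequently [OF freq ev]] by blast
  have x: "fst v \<noteq> 0" using nv v by (auto simp: vertical_def)
  then obtain B where B: "B *v fst v = - snd v" "norm B = norm (- snd v) / norm (fst v)"
    by (rule exists_matrix_mapping)
  have "norm B = exp T"
    using x v B(2) by (simp add: T(1) exp_diff)
  then have "shear B \<in> shears (exp T)" by (auto simp: shears_def)
  have "max_norm (shear B v) = norm (fst v)"
    by (simp add: max_norm_def shear_def case_prod_beta B(1))
  then have "- ln (norm (fst v)) \<le> ln (alpha1 (shear B ` \<Lambda>))"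
    using ln_alpha1_ge [OF \<Lambda> max_norm_le_shear _ v(1), of B]
    by (metis add_pos_nonneg norm_ge_zero zero_less_one)
  then have "z * T \<le> ln (alpha1 (shear B ` \<Lambda>))"
    using T by (simp add: algebra_simps)
  also have "ereal (ln (alpha1 (shear B ` \<Lambda>))) \<le> (SUP h\<in>shears (exp T). ereal (ln (alpha1 (h ` \<Lambda>))))"
    using \<open>shear B \<in> shears (exp T)\<close> by (rule SUP_upper)
  finally have "ereal z \<le> ?F (exp T)"
    using \<open>T > 0\<close> by (simp add: ereal_le_divide_pos mult.commute)
  with *(1) show False by simp
qed

lemma less_beta_exp_imp_Exp_set:
  fixes \<Lambda> :: "('m::finite, 'n::finite) space set"
  assumes \<Lambda>: "locally_finite_set \<Lambda>" "0 \<notin> \<Lambda>" and nv: "\<forall>v\<in>\<Lambda>. \<not> vertical v" and ne: "\<Lambda> \<noteq> {}"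
    and \<nu>: "\<nu> > 1" "ereal (1 - 1 / \<nu>) < beta_exp \<Lambda>"
  shows "\<nu> \<in> Exp_set \<Lambda>"
proof (rule Exp_setI [OF \<Lambda>(1) nv \<nu>(1)])
  let ?F = "\<lambda>s. (SUP h\<in>shears s. ereal (ln (alpha1 (h ` \<Lambda>)))) / ereal (ln s)"
  let ?b = "1 - 1 / \<nu>"
  have "\<not> (\<forall>\<^sub>F s in at_top. ?F s \<le> ereal ?b)"
    using Limsup_bounded [of ?F "ereal ?b" at_top] \<nu>(2) unfolding beta_exp_def by force
  then have "\<exists>\<^sub>F s in at_top. ereal ?b < ?F s"
    by (simp add: frequently_def not_less)
  then have fr: "\<exists>\<^sub>F s in at_top. ereal ?b < ?F s \<and> 1 < s"
    using eventually_gt_at_top [of "1 :: real"] by (rule frequently_eventually_frequently)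
  have main: "\<exists>v\<in>\<Lambda>. norm (fst v) < exp (- ?b * ln s) \<and> norm (snd v) \<le> 2 * exp (ln s / \<nu>)"
    if s: "ereal ?b < ?F s" "1 < s" for s
  proof -
    have "ereal (?b * ln s) < (SUP h\<in>shears s. ereal (ln (alpha1 (h ` \<Lambda>))))"
      using s by (simp add: ereal_less_divide_pos mult.commute)
    then obtain B :: "real ^ 'm ^ 'n" where B: "norm B \<le> s" "?b * ln s < ln (alpha1 (shear B ` \<Lambda>))"
      by (auto simp: less_SUP_iff shears_def)
    obtain v where v: "v \<in> \<Lambda>" "max_norm (shear B v) < exp (- (?b * ln s))"
      using ln_alpha1_gtD [OF \<Lambda> max_norm_le_shear _ B(2) ne]
      by (metis add_pos_nonneg norm_ge_zero zero_less_one)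
    let ?r = "exp (- (?b * ln s))"
    have x: "norm (fst v) < ?r" and z: "norm (B *v fst v + snd v) < ?r"
      using v(2) by (auto simp: max_norm_def shear_def case_prod_beta)
    have "norm (snd v) \<le> norm (B *v fst v + snd v) + norm (B *v fst v)"
      by (metis add_diff_cancel_left' norm_triangle_ineq4)
    also have "\<dots> \<le> ?r + s * ?r"
    proof -
      have "norm (B *v fst v) \<le> norm B * norm (fst v)" by (rule norm_matrix_vector_mult_le)
      also have "\<dots> \<le> s * ?r" using B(1) x s(2) by (intro mult_mono) auto
      finally show ?thesis using z by simp
    qed
    also have "\<dots> \<le> 2 * (s * ?r)" using s(2) by simp
    also have "s * ?r = exp (ln s + - (?b * ln s))" using s(2) by (subst exp_add) simp
    also have "ln s + - (?b * ln s) = ln s / \<nu>" by (simp add: algebra_simps)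
    finally show ?thesis using v(1) x by (intro bexI [of _ v]) (auto simp del: minus_diff_eq)
  qed
  show "\<exists>\<^sub>F T in at_top. \<exists>v\<in>\<Lambda>. norm (fst v) < exp (- ?b * T) \<and> norm (snd v) \<le> 2 * exp (T / \<nu>)"
    unfolding frequently_at_top_iff
  proof
    fix T0 :: real
    obtain s where s: "s \<ge> exp T0" "ereal ?b < ?F s" "1 < s"
      using fr unfolding frequently_at_top_iff by blast
    then have "T0 \<le> ln s" by (simp add: ln_ge_iff)
    then show "\<exists>T\<ge>T0. \<exists>v\<in>\<Lambda>. norm (fst v) < exp (- ?b * T) \<and> norm (snd v) \<le> 2 * exp (T / \<nu>)"
      using main [OF s(2,3)] by blast
  qed
qed

section \<open>The growth exponent along the diagonal flow\<close>

lemma diag_flow_exponent: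
  "real CARD('n::finite) * t / real (CARD('m::finite) + CARD('n)) =
    (1 - real CARD('m) / real (CARD('m) + CARD('n))) * t"
proof -
  have "real CARD('m) + real CARD('n) > 0" by (intro add_pos_pos) auto
  then show ?thesis by (simp add: field_simps)
qed

lemma gamma_exp_ge:
  fixes \<Lambda> :: "('m::finite, 'n::finite) space set"
  assumes \<Lambda>: "locally_finite_set \<Lambda>" "0 \<notin> \<Lambda>" and nv: "\<forall>v\<in>\<Lambda>. \<not> vertical v"
    and \<nu>: "\<nu> \<in> Exp_set \<Lambda>"
  shows "ereal (real CARD('m) / real (CARD('m) + CARD('n)) - 1 / \<nu>) \<le> gamma_exp \<Lambda>"
proof (rule ccontr)
  define p where "p = real CARD('m) / real (CARD('m) + CARD('n))"
  let ?G = "\<lambda>t. ln (alpha1 (diag_flow t ` \<Lambda>)) / t"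
  assume "\<not> ?thesis"
  then obtain z where z: "gamma_exp \<Lambda> < ereal z" "z < p - 1 / \<nu>"
    using ereal_dense2 [of "gamma_exp \<Lambda>" "ereal (p - 1 / \<nu>)"] by (auto simp: not_le p_def)
  have "\<forall>\<^sub>F t in at_top. ereal (?G t) < ereal z"
    using z(1) unfolding gamma_exp_def by (rule Limsup_lessD)
  then have ev: "\<forall>\<^sub>F t in at_top. ?G t < z \<and> t > 0"
    by (intro eventually_conj eventually_gt_at_top) simp
  have freq: "\<exists>\<^sub>F T in at_top. \<exists>v\<in>\<Lambda>. snd v \<noteq> 0 \<and> T = ln (norm (snd v)) - ln (norm (fst v)) \<and>
           ln (norm (snd v)) \<le> (p - z) * T"
    using z(2) by (intro Exp_set_frequently [OF nv \<nu>]) auto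
  obtain T v where *: "?G T < z" "T > 0" and v: "v \<in> \<Lambda>" "snd v \<noteq> 0"
    and T: "T = ln (norm (snd v)) - ln (norm (fst v))" "ln (norm (snd v)) \<le> (p - z) * T"
    using frequently_ex [OF frequently_eventually_frequently [OF freq ev]] by blast
  have x: "fst v \<noteq> 0" using nv v by (auto simp: vertical_def)
  have q: "real CARD('n) * T / real (CARD('m) + CARD('n)) = (1 - p) * T"
    unfolding p_def by (rule diag_flow_exponent)
  have "exp ((1 - p) * T) * norm (fst v) = exp ((1 - p) * T + ln (norm (fst v)))"
    using x by (simp add: exp_add)
  also have "(1 - p) * T + ln (norm (fst v)) = - (p * T) + ln (norm (snd v))"
    by (simp add: T(1) algebra_simps)
  also have "exp \<dots> = exp (- (p * T)) * norm (snd v)"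
    using v(2) by (subst exp_add) simp
  finally have "max_norm (diag_flow T v) = exp (- (p * T)) * norm (snd v)"
    unfolding max_norm_diag_flow q by (simp add: p_def)
  then have "- ln (max_norm (diag_flow T v)) = p * T - ln (norm (snd v))"
    using v(2) by (simp add: ln_mult)
  moreover obtain K where "K > 0" "\<And>v :: ('m, 'n) space. max_norm v \<le> K * max_norm (diag_flow T v)"
    using max_norm_le_diag_flow by blast
  ultimately have "p * T - ln (norm (snd v)) \<le> ln (alpha1 (diag_flow T ` \<Lambda>))"
    using ln_alpha1_ge [OF \<Lambda> _ _ v(1)] by metis
  then have "z * T \<le> ln (alpha1 (diag_flow T ` \<Lambda>))"
    using T(2) by (simp add: algebra_simps)
  then have "z \<le> ?G T" using \<open>T > 0\<close> by (simp add: field_simps)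
  with *(1) show False by simp
qed

lemma less_gamma_exp_imp_Exp_set:
  fixes \<Lambda> :: "('m::finite, 'n::finite) space set"
  assumes \<Lambda>: "locally_finite_set \<Lambda>" "0 \<notin> \<Lambda>" and nv: "\<forall>v\<in>\<Lambda>. \<not> vertical v" and ne: "\<Lambda> \<noteq> {}"
    and \<nu>: "\<nu> > 1" "ereal (real CARD('m) / real (CARD('m) + CARD('n)) - 1 / \<nu>) < gamma_exp \<Lambda>"
  shows "\<nu> \<in> Exp_set \<Lambda>"
proof (rule Exp_setI [OF \<Lambda>(1) nv \<nu>(1)])
  define p where "p = real CARD('m) / real (CARD('m) + CARD('n))"
  let ?G = "\<lambda>t. ln (alpha1 (diag_flow t ` \<Lambda>)) / t"
  have "\<not> (\<forall>\<^sub>F t in at_top. ereal (?G t) \<le> ereal (p - 1 / \<nu>))"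
    using Limsup_bounded [of "\<lambda>t. ereal (?G t)" "ereal (p - 1 / \<nu>)" at_top] \<nu>(2)
    unfolding gamma_exp_def p_def by force
  then have "\<exists>\<^sub>F t in at_top. p - 1 / \<nu> < ?G t"
    by (simp add: frequently_def not_less)
  then have "\<exists>\<^sub>F t in at_top. p - 1 / \<nu> < ?G t \<and> 0 < t"
    using eventually_gt_at_top [of "0 :: real"] by (rule frequently_eventually_frequently)
  then show "\<exists>\<^sub>F T in at_top. \<exists>v\<in>\<Lambda>. norm (fst v) < exp (- (1 - 1 / \<nu>) * T) \<and>
      norm (snd v) \<le> 2 * exp (T / \<nu>)"
  proof (rule frequently_elim1)
    fix t assume "p - 1 / \<nu> < ?G t \<and> 0 < t"
    then have "(p - 1 / \<nu>) * t < ln (alpha1 (diag_flow t ` \<Lambda>))"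
      using pos_less_divide_eq by blast
    moreover obtain K where "K > 0" "\<And>v :: ('m, 'n) space. max_norm v \<le> K * max_norm (diag_flow t v)"
      using max_norm_le_diag_flow by blast
    ultimately obtain v where v: "v \<in> \<Lambda>" "max_norm (diag_flow t v) < exp (- ((p - 1 / \<nu>) * t))"
      using ln_alpha1_gtD [OF \<Lambda> _ _ _ ne] by metis
    have q: "real CARD('n) * t / real (CARD('m) + CARD('n)) = (1 - p) * t"
      unfolding p_def by (rule diag_flow_exponent)
    have "exp ((1 - p) * t) * norm (fst v) < exp (- ((p - 1 / \<nu>) * t))"
      "exp (- (p * t)) * norm (snd v) < exp (- ((p - 1 / \<nu>) * t))"
      using v(2) unfolding max_norm_diag_flow q by (simp_all add: p_def)
    then have "norm (fst v) < exp (- ((p - 1 / \<nu>) * t)) / exp ((1 - p) * t)"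
      "norm (snd v) < exp (- ((p - 1 / \<nu>) * t)) / exp (- (p * t))"
      by (simp_all add: pos_less_divide_eq mult.commute)
    moreover have "- ((p - 1 / \<nu>) * t) - (1 - p) * t = - (1 - 1 / \<nu>) * t"
      "- ((p - 1 / \<nu>) * t) - - (p * t) = t / \<nu>"
      by (simp_all add: algebra_simps)
    ultimately have "norm (fst v) < exp (- (1 - 1 / \<nu>) * t)" "norm (snd v) < exp (t / \<nu>)"
      by (simp_all only: flip: exp_diff)
    moreover have "exp (t / \<nu>) \<le> 2 * exp (t / \<nu>)" by simp
    ultimately show "\<exists>v\<in>\<Lambda>. norm (fst v) < exp (- (1 - 1 / \<nu>) * t) \<and> norm (snd v) \<le> 2 * exp (t / \<nu>)"
      using v(1) by (intro bexI [of _ v]) linarith+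
  qed
qed

section \<open>The four statements\<close>

lemma diff_less_if_less_one_divide_ereal:
  fixes \<gamma> :: ereal
  assumes "\<nu> > 0" "ereal \<nu> < 1 / (ereal a - \<gamma>)"
  shows "ereal (a - 1 / \<nu>) < \<gamma>"
proof (cases \<gamma>)
  case (real r)
  show ?thesis
  proof (cases "a = r")
    case True
    then show ?thesis using real assms by simp
  next
    case False
    then have lt: "\<nu> < 1 / (a - r)" using real assms by (simp add: one_ereal_def)
    then have "a - r > 0" using assms(1) by (smt (verit) divide_nonneg_nonpos)
    with lt assms(1) show ?thesis using real by (simp add: field_simps)
  qed
qed (use assms in auto)

theorem theorem4p1:
  fixes \<Lambda> :: "((real ^ 'm::finite) \<times> (real ^ 'n::finite)) set"
    and \<beta> \<gamma> :: ereal
    and m d :: real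
  defines "\<beta> \<equiv> beta_exp \<Lambda>"
    and "\<gamma> \<equiv> gamma_exp \<Lambda>"
    and "m \<equiv> real CARD('m)"
    and "d \<equiv> real (CARD('m) + CARD('n))"
  assumes "0 \<notin> \<Lambda>"
    and "locally_finite_set \<Lambda>"
    and "\<forall>v\<in>\<Lambda>. \<not> vertical v"
    and "Exp_set \<Lambda> \<noteq> {}"
  shows "(\<forall>\<nu>\<in>Exp_set \<Lambda>. \<beta> \<ge> ereal (1 - 1 / \<nu>)) \<and>
         (\<beta> > 0 \<longrightarrow> {\<nu>::real. 1 < ereal \<nu> \<and> ereal \<nu> < 1 / (1 - \<beta>)} \<subseteq> Exp_set \<Lambda>) \<and>
         (\<forall>\<nu>\<in>Exp_set \<Lambda>. \<gamma> \<ge> ereal (m / d - 1 / \<nu>)) \<and>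
         (\<gamma> \<ge> 0 \<longrightarrow> {\<nu>::real. 0 < ereal \<nu> \<and> ereal \<nu> < 1 / (ereal (m / d) - \<gamma>)} \<subseteq> Exp_set \<Lambda>)"
proof -
  have ne: "\<Lambda> \<noteq> {}"
    using \<open>Exp_set \<Lambda> \<noteq> {}\<close> by (auto simp: Exp_set_def)
  note \<Lambda> = \<open>locally_finite_set \<Lambda>\<close> \<open>0 \<notin> \<Lambda>\<close> and nv = \<open>\<forall>v\<in>\<Lambda>. \<not> vertical v\<close>
  have "\<nu> \<in> Exp_set \<Lambda>" if "1 < \<nu>" "ereal \<nu> < 1 / (1 - \<beta>)" for \<nu> :: real
  proof -
    have "ereal (1 - 1 / \<nu>) < \<beta>"
      using that by (intro diff_less_if_less_one_divide_ereal) (auto simp: one_ereal_def)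
    then show ?thesis
      using less_beta_exp_imp_Exp_set [OF \<Lambda> nv ne that(1)] by (simp add: \<beta>_def)
  qed
  moreover have "\<nu> \<in> Exp_set \<Lambda>"
    if "\<gamma> \<ge> 0" "0 < \<nu>" "ereal \<nu> < 1 / (ereal (m / d) - \<gamma>)" for \<nu> :: real
  proof -
    have \<nu>: "ereal (m / d - 1 / \<nu>) < \<gamma>"
      using that by (intro diff_less_if_less_one_divide_ereal) auto
    \<comment> \<open>Some exponent \<open>\<mu> > 1\<close> above \<open>\<nu>\<close> still satisfies the inequality: since \<open>n \<ge> 1\<close>,
      every \<open>\<mu>\<close> in \<open>(1, d/m)\<close> makes its left-hand side negative.\<close>
    have "\<exists>\<mu>>1. \<nu> \<le> \<mu> \<and> ereal (m / d - 1 / \<mu>) < \<gamma>"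
    proof (cases "\<nu> > 1")
      case True
      with \<nu> show ?thesis by blast
    next
      case False
      have "m > 0" "m < d" by (auto simp: m_def d_def)
      then have "1 < d / m" by simp
      then obtain \<mu> where \<mu>: "1 < \<mu>" "\<mu> < d / m" using dense by blast
      then have "m / d - 1 / \<mu> < 0" using \<open>m > 0\<close> \<open>m < d\<close> by (simp add: field_simps)
      then have "ereal (m / d - 1 / \<mu>) < \<gamma>"
        using \<open>\<gamma> \<ge> 0\<close> by (metis less_ereal.simps(1) less_le_trans zero_ereal_def)
      with \<mu> False show ?thesis by (intro exI [of _ \<mu>]) auto
    qed
    then obtain \<mu> where \<mu>: "\<mu> > 1" "\<nu> \<le> \<mu>" "ereal (m / d - 1 / \<mu>) < \<gamma>" by blast
    then have "\<mu> \<in> Exp_set \<Lambda>"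
      using less_gamma_exp_imp_Exp_set [OF \<Lambda> nv ne] by (simp add: \<gamma>_def m_def d_def)
    then show ?thesis using Exp_set_downward \<open>0 < \<nu>\<close> \<mu>(2) by blast
  qed
  ultimately show ?thesis
    using beta_exp_ge [OF \<Lambda> nv] gamma_exp_ge [OF \<Lambda> nv]
    by (auto simp: \<beta>_def \<gamma>_def m_def d_def one_ereal_def zero_ereal_def)
qed

end
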